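(* Let $\mathcal{X}$ be a topological space on a nonempty set $X$. The following are equivalent: a) $\mathcal{X}$ is compact; b) the nonempty closed sets in $\mathcal{X}$ form an $\mathbf{S}_1$ ball space on $X$; c) the nonempty closed sets in $\mathcal{X}$ form an $\mathbf{S}^*$ ball space on $X$.
   Context: "Compact" means that every open cover has a finite subcover; the Hausdorff property is not assumed. A ball space $(X,\mathcal{B})$ consists of a nonempty set $X$ and a nonempty family $\mathcal{B}$ of nonempty subsets of $X$, called balls. A nest of balls is a nonempty subset of $\mathcal{B}$ totally ordered by inclusion. A centered system of balls is a nonempty collection of balls such that the intersection of any finite number of balls in the collection is nonempty. $(X,\mathcal{B})$ is an $\mathbf{S}_1$ ball space if the intersection of each nest of balls is nonempty, and an $\mathbf{S}^*$ ball space if the intersection of each centered system of balls is a ball. *)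

theory Defs
  imports "HOL-Analysis.Analysis"
begin

definition ball_space :: "'a set \<Rightarrow> 'a set set \<Rightarrow> bool" where
  "ball_space X \<B> \<longleftrightarrow> X \<noteq> {} \<and> \<B> \<noteq> {} \<and> (\<forall>B\<in>\<B>. B \<noteq> {} \<and> B \<subseteq> X)"

definition nest_of_balls :: "'a set set \<Rightarrow> 'a set set \<Rightarrow> bool" where
  "nest_of_balls \<B> \<N> \<longleftrightarrow>
     \<N> \<noteq> {} \<and> \<N> \<subseteq> \<B> \<and> (\<forall>A\<in>\<N>. \<forall>B\<in>\<N>. A \<subseteq> B \<or> B \<subseteq> A)"

text \<open>Only nonempty finite subfamilies are intersected, since \<open>\<Inter>{}\<close> is \<open>UNIV\<close> here.\<close>

definition centered_system :: "'a set set \<Rightarrow> 'a set set \<Rightarrow> bool" where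
  "centered_system \<B> \<C> \<longleftrightarrow>
     \<C> \<noteq> {} \<and> \<C> \<subseteq> \<B> \<and>
     (\<forall>\<F>. finite \<F> \<and> \<F> \<noteq> {} \<and> \<F> \<subseteq> \<C> \<longrightarrow> \<Inter>\<F> \<noteq> {})"

definition S1_ball_space :: "'a set \<Rightarrow> 'a set set \<Rightarrow> bool" where
  "S1_ball_space X \<B> \<longleftrightarrow>
     ball_space X \<B> \<and> (\<forall>\<N>. nest_of_balls \<B> \<N> \<longrightarrow> \<Inter>\<N> \<noteq> {})"

definition S_star_ball_space :: "'a set \<Rightarrow> 'a set set \<Rightarrow> bool" where
  "S_star_ball_space X \<B> \<longleftrightarrow>
     ball_space X \<B> \<and> (\<forall>\<C>. centered_system \<B> \<C> \<longrightarrow> \<Inter>\<C> \<in> \<B>)"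

end

theory Submission
  imports Defs
begin

text \<open>
  Compactness says that every centered system of nonempty closed sets has a nonempty intersection,
  and this intersection is then again a nonempty closed set; so compactness and the
  \<open>S*\<close> property agree.  A nest is centered because a finite chain of sets has a least
  member, so \<open>S*\<close> implies \<open>S\<^sub>1\<close>.

  The one substantial step is to get from nests back to centered systems.  It holds in every family
  \<open>\<B>\<close> that contains each nonempty intersection of its members
  (\<open>Inter_centered_nonempty\<close>), by induction on the cardinality of the centered system
  \<open>\<C>\<close>.  If \<open>\<C>\<close> is infinite, enumerate it along its
  initial ordinal.  Every proper initial segment has smaller cardinality, so its intersection is
  nonempty and therefore a ball.  These intersections decrease along the enumeration: they form a
  nest, whose intersection is that of \<open>\<C>\<close>.
\<close>

context
  includes cardinal_syntax
begin

text \<open>Initial segments are taken with their endpoint, so that they are nonempty and cover the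
  whole set.  In an initial ordinal the segments without endpoint are smaller than the whole set,
  and one more point makes no difference when the whole set is infinite.\<close>

lemma card_of_under_ordLess:
  assumes "infinite A" and "a \<in> A"
  shows "|under |A| a| <o |A|"
proof -
  have "|underS |A| a| <o |A|"
    using card_of_underS[OF card_of_Card_order, of a A] assms(2) by (simp add: Field_card_of)
  moreover have "|{a}| <o |A|"
    using assms(1) card_of_ordLeq_finite[of A "{a}"] ordLess_or_ordLeq[OF card_of_Well_order card_of_Well_order]
    by blast
  ultimately have "|underS |A| a \<union> {a}| <o |A|"
    using assms(1) by (rule card_of_Un_ordLess_infinite[rotated])
  moreover have "under |A| a \<subseteq> underS |A| a \<union> {a}"
    by (auto simp: under_def underS_def)
  ultimately show ?thesis
    using card_of_mono1 ordLeq_ordLess_trans by blast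
qed

lemma centered_system_subset:
  assumes "centered_system \<B> \<C>" and "\<D> \<subseteq> \<C>" and "\<D> \<noteq> {}"
  shows "centered_system \<B> \<D>"
  using assms unfolding centered_system_def by (meson subset_trans)

text \<open>Closure under nonempty intersections is what turns the partial intersections of a centered
  system into balls, to which the hypothesis on nests can be applied.\<close>

lemma Inter_centered_nonempty:
  assumes Inter_ball: "\<And>\<D>. \<D> \<noteq> {} \<Longrightarrow> \<D> \<subseteq> \<B> \<Longrightarrow> \<Inter>\<D> \<noteq> {} \<Longrightarrow> \<Inter>\<D> \<in> \<B>"
    and nest: "\<And>\<N>. nest_of_balls \<B> \<N> \<Longrightarrow> \<Inter>\<N> \<noteq> {}"
    and "centered_system \<B> \<C>"
  shows "\<Inter>\<C> \<noteq> {}"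
  using assms(3)
proof (induction \<C> rule: wf_induct_rule[OF wf_inv_image[OF wf_ordLess, of card_of]])
  case (1 \<C>)
  show ?case
  proof (cases "finite \<C>")
    case True
    with 1(2) show ?thesis by (auto simp: centered_system_def)
  next
    case False
    define seg where "seg = under |\<C>|"
    have wo: "Well_order |\<C>|" by (rule card_of_Well_order)
    have seg_refl: "C \<in> seg C" if "C \<in> \<C>" for C
      using wo that by (auto simp: seg_def under_def order_on_defs refl_on_def Field_card_of)
    have seg_subset: "seg C \<subseteq> \<C>" for C
      using under_Field[of "|\<C>|" C] by (simp add: seg_def Field_card_of)
    have seg_linear: "seg C \<subseteq> seg D \<or> seg D \<subseteq> seg C" if "C \<in> \<C>" "D \<in> \<C>" for C D
    proof -
      have "trans |\<C>|" "C = D \<or> (C, D) \<in> |\<C>| \<or> (D, C) \<in> |\<C>|"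
        using wo that by (auto simp: order_on_defs total_on_def Field_card_of)
      then show ?thesis
        unfolding seg_def under_def by (auto dest: transD)
    qed
    have Inter_seg: "\<Inter>(seg C) \<in> \<B>" if "C \<in> \<C>" for C
    proof (rule Inter_ball)
      show "seg C \<noteq> {}" using seg_refl[OF that] by blast
      then have "centered_system \<B> (seg C)"
        using centered_system_subset[OF 1(2) seg_subset] by blast
      moreover have "|seg C| <o |\<C>|"
        unfolding seg_def using card_of_under_ordLess[OF False that] .
      ultimately show "\<Inter>(seg C) \<noteq> {}" using 1(1) by simp
      show "seg C \<subseteq> \<B>"
        using seg_subset 1(2) by (auto simp: centered_system_def)
    qed
    have "nest_of_balls \<B> ((\<lambda>C. \<Inter>(seg C)) ` \<C>)"
      unfolding nest_of_balls_def
    proof (intro conjI)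
      show "(\<lambda>C. \<Inter>(seg C)) ` \<C> \<noteq> {}" using False by auto
      show "(\<lambda>C. \<Inter>(seg C)) ` \<C> \<subseteq> \<B>" using Inter_seg by blast
      show "\<forall>A\<in>(\<lambda>C. \<Inter>(seg C)) ` \<C>. \<forall>B\<in>(\<lambda>C. \<Inter>(seg C)) ` \<C>. A \<subseteq> B \<or> B \<subseteq> A"
        using seg_linear by (auto dest!: Inter_anti_mono)
    qed
    then have "(\<Inter>C\<in>\<C>. \<Inter>(seg C)) \<noteq> {}" by (rule nest)
    moreover have "(\<Inter>C\<in>\<C>. \<Inter>(seg C)) \<subseteq> \<Inter>\<C>" using seg_refl by blast
    ultimately show ?thesis by blast
  qed
qed

end

lemma nest_imp_centered_system:
  assumes "nest_of_balls \<B> \<N>" and "{} \<notin> \<B>"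
  shows "centered_system \<B> \<N>"
  unfolding centered_system_def
proof (intro conjI allI impI)
  show "\<N> \<noteq> {}" "\<N> \<subseteq> \<B>" using assms(1) by (auto simp: nest_of_balls_def)
  fix \<F> assume F: "finite \<F> \<and> \<F> \<noteq> {} \<and> \<F> \<subseteq> \<N>"
  then have "subset.chain \<N> \<F>"
    using assms(1) unfolding nest_of_balls_def subset_chain_def by (meson subsetD)
  then have "\<Inter>\<F> \<in> \<F>"
    using F Inter_in_chain by blast
  then show "\<Inter>\<F> \<noteq> {}"
    using F assms unfolding nest_of_balls_def by (metis subsetD)
qed

lemma S1_iff_S_star:
  assumes Inter_ball: "\<And>\<D>. \<D> \<noteq> {} \<Longrightarrow> \<D> \<subseteq> \<B> \<Longrightarrow> \<Inter>\<D> \<noteq> {} \<Longrightarrow> \<Inter>\<D> \<in> \<B>"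
  shows "S1_ball_space X \<B> \<longleftrightarrow> S_star_ball_space X \<B>"
proof
  assume S1: "S1_ball_space X \<B>"
  have "\<Inter>\<C> \<in> \<B>" if "centered_system \<B> \<C>" for \<C>
  proof (rule Inter_ball)
    show "\<C> \<noteq> {}" "\<C> \<subseteq> \<B>" using that by (auto simp: centered_system_def)
    show "\<Inter>\<C> \<noteq> {}"
      using Inter_centered_nonempty[OF Inter_ball _ that] S1 by (auto simp: S1_ball_space_def)
  qed
  with S1 show "S_star_ball_space X \<B>"
    by (simp add: S1_ball_space_def S_star_ball_space_def)
next
  assume S: "S_star_ball_space X \<B>"
  then have "{} \<notin> \<B>" by (auto simp: S_star_ball_space_def ball_space_def)
  with S show "S1_ball_space X \<B>"
    unfolding S1_ball_space_def S_star_ball_space_def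
    by (metis nest_imp_centered_system)
qed

text \<open>This is the finite intersection characterization of compactness, up to the empty family,
  whose intersection is the whole type and hence nonempty, and up to the requirement that the
  intersection be a ball, which is automatic for closed sets.\<close>

lemma compact_space_iff_S_star:
  assumes "topspace T \<noteq> {}"
  shows "compact_space T \<longleftrightarrow> S_star_ball_space (topspace T) {C. closedin T C \<and> C \<noteq> {}}"
    (is "_ \<longleftrightarrow> S_star_ball_space _ ?\<B>")
proof -
  have ball: "ball_space (topspace T) ?\<B>"
    using assms closedin_topspace[of T] by (auto simp: ball_space_def dest: closedin_subset)
  show ?thesis
  proof
    assume compact: "compact_space T"
    have "\<Inter>\<C> \<in> ?\<B>" if "centered_system ?\<B> \<C>" for \<C>
    proof -
      have closed: "\<C> \<noteq> {}" "\<forall>C\<in>\<C>. closedin T C"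
        and fip: "\<forall>\<F>. finite \<F> \<and> \<F> \<subseteq> \<C> \<longrightarrow> \<Inter>\<F> \<noteq> {}"
        using that unfolding centered_system_def by (blast, blast, metis Inter_empty UNIV_not_empty)
      then have "\<Inter>\<C> \<noteq> {}"
        using compact[unfolded compact_space_fip] by blast
      with closed show ?thesis by auto
    qed
    with ball show "S_star_ball_space (topspace T) ?\<B>"
      by (simp add: S_star_ball_space_def)
  next
    assume S: "S_star_ball_space (topspace T) ?\<B>"
    show "compact_space T"
      unfolding compact_space_fip
    proof (intro allI impI)
      fix \<U> assume U: "(\<forall>C\<in>\<U>. closedin T C) \<and> (\<forall>\<F>. finite \<F> \<and> \<F> \<subseteq> \<U> \<longrightarrow> \<Inter>\<F> \<noteq> {})"
      show "\<Inter>\<U> \<noteq> {}"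
      proof (cases "\<U> = {}")
        case False
        have "C \<noteq> {}" if "C \<in> \<U>" for C
          using U[THEN conjunct2, rule_format, of "{C}"] that by simp
        with U False have "centered_system ?\<B> \<U>"
          by (auto simp: centered_system_def)
        with S show ?thesis by (auto simp: S_star_ball_space_def)
      qed simp
    qed
  qed
qed

theorem theorem5p19:
  fixes T :: "'a topology"
  assumes "topspace T \<noteq> {}"
  shows "(compact_space T \<longleftrightarrow> S1_ball_space (topspace T) {C. closedin T C \<and> C \<noteq> {}}) \<and>
         (S1_ball_space (topspace T) {C. closedin T C \<and> C \<noteq> {}} \<longleftrightarrow>
          S_star_ball_space (topspace T) {C. closedin T C \<and> C \<noteq> {}})"
proof -
  have "S1_ball_space (topspace T) {C. closedin T C \<and> C \<noteq> {}} \<longleftrightarrow>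
        S_star_ball_space (topspace T) {C. closedin T C \<and> C \<noteq> {}}"
    by (rule S1_iff_S_star) auto
  with compact_space_iff_S_star[OF assms] show ?thesis by blast
qed

end
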